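(* Let $G$ be a group with a 3-cocycle $\phi:G^3\to k^*$, $k$ a field. Let $|i|\in G$ for $i=1,\dots,n$ be a choice of grading function. Then the usual $n\times n$ matrices $M_n$ over $k$ with the new product $$(\alpha\cdot\beta)^i{}_j=\sum_k\alpha^i{}_k\,\beta^k{}_j\,\frac{\phi(|i|,|k|^{-1},|k||j|^{-1})}{\phi(|k|^{-1},|k|,|j|^{-1})},\qquad\alpha,\beta\in M_n,$$ form a $G$-graded quasialgebra $M_{n,\phi}$, where $|E_i{}^j|=|i||j|^{-1}\in G$ is the degree of the usual basis element $E_i{}^j$ of $M_n$ (the matrix with entry $1$ in row $i$ and column $j$ and $0$ elsewhere). An action of a $G$-graded quasialgebra $A$ on the $n$-dimensional vector space with basis $e_1,\dots,e_n$ graded by $|e_i|=|i|$ is equivalent to an algebra map $\rho:A\to M_{n,\phi}$.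
   Context: A 3-cocycle on $G$ (identity $e$) is $\phi:G^3\to k^*$ with $\phi(y,z,w)\phi(x,yz,w)\phi(x,y,z)=\phi(x,y,zw)\phi(xy,z,w)$ and $\phi(x,e,y)=1$. A $G$-graded quasialgebra is a $G$-graded vector space $A$ with a degree-preserving product, with unit $1$ of degree $e$, such that $(ab)c=a(bc)\,\phi(|a|,|b|,|c|)$ on homogeneous elements. Algebra maps between $G$-graded quasialgebras are degree-preserving linear maps respecting products and units. An action of $A$ on a $G$-graded vector space $V$ is a degree-preserving map $\triangleright:A\otimes V\to V$ (so $|a\triangleright v|=|a||v|$) such that $(ab)\triangleright v=\phi(|a|,|b|,|v|)\,a\triangleright(b\triangleright v)$ and $1\triangleright v=v$ on homogeneous elements. *)

theory Defs
  imports "HOL-Analysis.Cartesian_Space" "HOL-Algebra.Group"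
begin

locale three_cocycle = group G
  for G :: "('g, 'm) monoid_scheme" (structure)
  and \<phi> :: "'g \<Rightarrow> 'g \<Rightarrow> 'g \<Rightarrow> 'k::field" +
  assumes cocycle_nonzero:
      "\<lbrakk>x \<in> carrier G; y \<in> carrier G; z \<in> carrier G\<rbrakk> \<Longrightarrow> \<phi> x y z \<noteq> 0"
    and cocycle_eq:
      "\<lbrakk>x \<in> carrier G; y \<in> carrier G; z \<in> carrier G; w \<in> carrier G\<rbrakk>
        \<Longrightarrow> \<phi> y z w * \<phi> x (y \<otimes> z) w * \<phi> x y z = \<phi> x y (z \<otimes> w) * \<phi> (x \<otimes> y) z w"
    and cocycle_unit:
      "\<lbrakk>x \<in> carrier G; y \<in> carrier G\<rbrakk> \<Longrightarrow> \<phi> x \<one> y = 1"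

text \<open>
  \<^term>\<open>V g\<close> is the subspace of elements of degree \<^term>\<open>g\<close> (it contains 0); the space is the
  internal direct sum of the \<^term>\<open>V g\<close>, with \<^term>\<open>g\<close> ranging over the group. Values of
  \<^term>\<open>V\<close> outside \<^term>\<open>carrier G\<close> are irrelevant.
\<close>

locale graded_space = vector_space scale
  for G :: "('g, 'm) monoid_scheme" (structure)
  and scale :: "'k::field \<Rightarrow> 'v::ab_group_add \<Rightarrow> 'v"
  and V :: "'g \<Rightarrow> 'v set" +
  assumes component_subspace: "g \<in> carrier G \<Longrightarrow> subspace (V g)"
    and direct_sum:
      "\<exists>!f. (\<forall>g \<in> carrier G. f g \<in> V g) \<and> (\<forall>g. g \<notin> carrier G \<longrightarrow> f g = 0) \<and>
            finite {g. f g \<noteq> 0} \<and> v = (\<Sum>g | f g \<noteq> 0. f g)"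

definition bilinear_over ::
    "('k::field \<Rightarrow> 'a::ab_group_add \<Rightarrow> 'a) \<Rightarrow> ('k \<Rightarrow> 'b::ab_group_add \<Rightarrow> 'b) \<Rightarrow>
     ('k \<Rightarrow> 'c::ab_group_add \<Rightarrow> 'c) \<Rightarrow> ('a \<Rightarrow> 'b \<Rightarrow> 'c) \<Rightarrow> bool" where
  "bilinear_over sa sb sc f \<longleftrightarrow>
     (\<forall>a. Vector_Spaces.linear sb sc (f a)) \<and> (\<forall>b. Vector_Spaces.linear sa sc (\<lambda>a. f a b))"

locale graded_quasialgebra = three_cocycle G \<phi> + graded_space G scale A
  for G :: "('g, 'm) monoid_scheme" (structure)
  and \<phi> :: "'g \<Rightarrow> 'g \<Rightarrow> 'g \<Rightarrow> 'k::field"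
  and scale :: "'k \<Rightarrow> 'a::ab_group_add \<Rightarrow> 'a"
  and A :: "'g \<Rightarrow> 'a set"
  and mul :: "'a \<Rightarrow> 'a \<Rightarrow> 'a"
  and unit :: 'a +
  assumes mul_bilinear: "bilinear_over scale scale scale mul"
    and mul_degree:
      "\<lbrakk>g \<in> carrier G; h \<in> carrier G; a \<in> A g; b \<in> A h\<rbrakk> \<Longrightarrow> mul a b \<in> A (g \<otimes> h)"
    and unit_degree: "unit \<in> A \<one>"
    and unit_left: "mul unit a = a"
    and unit_right: "mul a unit = a"
    and quasi_assoc:
      "\<lbrakk>g \<in> carrier G; h \<in> carrier G; l \<in> carrier G; a \<in> A g; b \<in> A h; c \<in> A l\<rbrakk>
        \<Longrightarrow> mul (mul a b) c = scale (\<phi> g h l) (mul a (mul b c))"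

definition quasialgebra_map ::
    "('g, 'm) monoid_scheme \<Rightarrow>
     ('k::field \<Rightarrow> 'a::ab_group_add \<Rightarrow> 'a) \<Rightarrow> ('g \<Rightarrow> 'a set) \<Rightarrow> ('a \<Rightarrow> 'a \<Rightarrow> 'a) \<Rightarrow> 'a \<Rightarrow>
     ('k \<Rightarrow> 'b::ab_group_add \<Rightarrow> 'b) \<Rightarrow> ('g \<Rightarrow> 'b set) \<Rightarrow> ('b \<Rightarrow> 'b \<Rightarrow> 'b) \<Rightarrow> 'b \<Rightarrow>
     ('a \<Rightarrow> 'b) \<Rightarrow> bool" where
  "quasialgebra_map G sa A mulA unitA sb B mulB unitB \<rho> \<longleftrightarrow>
     Vector_Spaces.linear sa sb \<rho> \<and>
     (\<forall>g \<in> carrier G. \<forall>a \<in> A g. \<rho> a \<in> B g) \<and>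
     (\<forall>a b. \<rho> (mulA a b) = mulB (\<rho> a) (\<rho> b)) \<and>
     \<rho> unitA = unitB"

definition quasialgebra_action ::
    "('g, 'm) monoid_scheme \<Rightarrow> ('g \<Rightarrow> 'g \<Rightarrow> 'g \<Rightarrow> 'k::field) \<Rightarrow>
     ('k \<Rightarrow> 'a::ab_group_add \<Rightarrow> 'a) \<Rightarrow> ('g \<Rightarrow> 'a set) \<Rightarrow> ('a \<Rightarrow> 'a \<Rightarrow> 'a) \<Rightarrow> 'a \<Rightarrow>
     ('k \<Rightarrow> 'v::ab_group_add \<Rightarrow> 'v) \<Rightarrow> ('g \<Rightarrow> 'v set) \<Rightarrow> ('a \<Rightarrow> 'v \<Rightarrow> 'v) \<Rightarrow> bool" where
  "quasialgebra_action G \<phi> sa A mulA unitA sv V act \<longleftrightarrow>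
     bilinear_over sa sv sv act \<and>
     (\<forall>g \<in> carrier G. \<forall>h \<in> carrier G. \<forall>a \<in> A g. \<forall>v \<in> V h. act a v \<in> V (g \<otimes>\<^bsub>G\<^esub> h)) \<and>
     (\<forall>g \<in> carrier G. \<forall>h \<in> carrier G. \<forall>l \<in> carrier G. \<forall>a \<in> A g. \<forall>b \<in> A h. \<forall>v \<in> V l.
        act (mulA a b) v = sv (\<phi> g h l) (act a (act b v))) \<and>
     (\<forall>v. act unitA v = v)"

definition vec_grading :: "('n::finite \<Rightarrow> 'g) \<Rightarrow> 'g \<Rightarrow> ('k::field ^ 'n) set" where
  "vec_grading d g = module.span (*s) {axis i 1 | i. d i = g}"

definition mat_scale :: "'k::field \<Rightarrow> 'k ^ 'n ^ 'n \<Rightarrow> 'k ^ 'n ^ 'n" where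
  "mat_scale c M = (\<chi> i j. c * M $ i $ j)"

definition mat_unit :: "'n::finite \<Rightarrow> 'n \<Rightarrow> 'k::field ^ 'n ^ 'n" where
  "mat_unit i j = (\<chi> p q. if p = i \<and> q = j then 1 else 0)"

definition mat_grading ::
    "('g, 'm) monoid_scheme \<Rightarrow> ('n::finite \<Rightarrow> 'g) \<Rightarrow> 'g \<Rightarrow> ('k::field ^ 'n ^ 'n) set" where
  "mat_grading G d g =
     module.span mat_scale {mat_unit i j | i j. d i \<otimes>\<^bsub>G\<^esub> inv\<^bsub>G\<^esub> d j = g}"

definition mat_qmul ::
    "('g, 'm) monoid_scheme \<Rightarrow> ('g \<Rightarrow> 'g \<Rightarrow> 'g \<Rightarrow> 'k::field) \<Rightarrow> ('n::finite \<Rightarrow> 'g) \<Rightarrow>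
     'k ^ 'n ^ 'n \<Rightarrow> 'k ^ 'n ^ 'n \<Rightarrow> 'k ^ 'n ^ 'n" where
  "mat_qmul G \<phi> d \<alpha> \<beta> = (\<chi> i j. \<Sum>k\<in>UNIV. \<alpha> $ i $ k * \<beta> $ k $ j *
     (\<phi> (d i) (inv\<^bsub>G\<^esub> d k) (d k \<otimes>\<^bsub>G\<^esub> inv\<^bsub>G\<^esub> d j) / \<phi> (inv\<^bsub>G\<^esub> d k) (d k) (inv\<^bsub>G\<^esub> d j)))"

text \<open>
  The unit of the deformed product is diagonal but in general not the identity matrix:
  solving \<^term>\<open>mat_qmul G \<phi> d u (mat_unit i j) = mat_unit i j\<close> for a diagonal \<^term>\<open>u\<close>,
  and using the cocycle identity, forces the entries below.
\<close>

definition mat_qunit ::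
    "('g, 'm) monoid_scheme \<Rightarrow> ('g \<Rightarrow> 'g \<Rightarrow> 'g \<Rightarrow> 'k::field) \<Rightarrow> ('n::finite \<Rightarrow> 'g) \<Rightarrow> 'k ^ 'n ^ 'n" where
  "mat_qunit G \<phi> d = (\<chi> i j. if i = j then 1 / \<phi> (d i) (inv\<^bsub>G\<^esub> d i) (d i) else 0)"

text \<open>
  The deformed matrices act on column vectors by
  \<open>M \<rhd> e\<^sub>j = \<Sum>\<^sub>i M\<^sup>i\<^sub>j \<phi>(|i|, |j|\<^sup>-\<^sup>1, |j|) e\<^sub>i\<close>. The cocycle factor is needed: ordinary
  matrix-vector multiplication is in general not an action in the quasi-associative sense.
\<close>

definition mat_qact ::
    "('g, 'm) monoid_scheme \<Rightarrow> ('g \<Rightarrow> 'g \<Rightarrow> 'g \<Rightarrow> 'k::field) \<Rightarrow> ('n::finite \<Rightarrow> 'g) \<Rightarrow>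
     'k ^ 'n ^ 'n \<Rightarrow> 'k ^ 'n \<Rightarrow> 'k ^ 'n" where
  "mat_qact G \<phi> d M v =
     (\<chi> i. \<Sum>j\<in>UNIV. M $ i $ j * \<phi> (d i) (inv\<^bsub>G\<^esub> d j) (d j) * v $ j)"

end

theory Submission
  imports Defs
begin

text \<open>
  The deformed matrix algebra is the algebra of endomorphisms of the graded space \<open>V = k\<^sup>n\<close>,
  written in coordinates suited to the quasi-associative setting. A matrix \<open>M\<close> acts on \<open>V\<close> through
  the ordinary matrix with entries \<open>M\<^sup>i\<^sub>j \<phi>(|i|, |j|\<^sup>-\<^sup>1, |j|)\<close>. The factors
  \<open>\<phi>(|i|, |j|\<^sup>-\<^sup>1, |j|)\<close> are nonzero, so this identifies matrices with linear
  endomorphisms of \<open>V\<close>; in particular the action is faithful. The deformed product is then the one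
  forced by the action law \<open>(MN) \<rhd> v = \<phi>(|M|,|N|,|v|) M \<rhd> (N \<rhd> v)\<close>: on matrix units this law
  amounts to the scalar identity \<open>deformation_identity\<close>, which combines two instances of the cocycle
  equation.

  Once the matrices are known to act faithfully, everything else is formal. A product that
  satisfies the action law for a faithful action is quasi-associative
  (\<open>graded_quasialgebra_of_faithful_action\<close>): comparing \<open>(ab)c\<close> and \<open>a(bc)\<close> on a vector is
  exactly the cocycle equation. An algebra map into the matrices pulls the action back
  (\<open>quasialgebra_action_pullback\<close>). Conversely, an action of \<open>A\<close> sends each \<open>a\<close> to an
  endomorphism of \<open>V\<close>, hence to a unique matrix \<open>\<rho> a\<close>, and faithfulness transports the action law
  into multiplicativity of \<open>\<rho>\<close> (\<open>quasialgebra_map_of_faithful_action\<close>).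

  The cocycle relates values only on homogeneous elements, so each identity is first proved there
  and then extended by linearity (\<open>linear_eq_on_homogeneous\<close>).
\<close>

section \<open>Cocycles and graded spaces\<close>

context three_cocycle
begin

lemma cocycle_unit_left:
  assumes "x \<in> carrier G" "y \<in> carrier G"
  shows "\<phi> \<one> x y = 1"
  using cocycle_eq[of \<one> \<one> x y] cocycle_unit[of \<one> "x \<otimes> y"] cocycle_unit[of \<one> x]
    cocycle_nonzero[of \<one> x y] assms
  by simp

lemma cocycle_unit_right:
  assumes "x \<in> carrier G" "y \<in> carrier G"
  shows "\<phi> x y \<one> = 1"
  using cocycle_eq[of x y \<one> \<one>] cocycle_unit[of y \<one>] cocycle_unit[of "x \<otimes> y" \<one>]
    cocycle_nonzero[of x y \<one>] assms
  by simp

text \<open>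
  With \<open>x, y, z = |i|, |k|, |j|\<close>, this is the action law for the matrix units \<open>E\<^sub>i\<^sup>k\<close> and
  \<open>E\<^sub>k\<^sup>j\<close> applied to \<open>e\<^sub>j\<close>. The cocycle equation at \<open>(x, y\<^sup>-\<^sup>1, yz\<^sup>-\<^sup>1, z)\<close> relates
  both sides up to the factor \<open>\<phi>(y\<^sup>-\<^sup>1, yz\<^sup>-\<^sup>1, z)\<close>, which the equation at
  \<open>(y\<^sup>-\<^sup>1, y, z\<^sup>-\<^sup>1, z)\<close> eliminates.
\<close>

lemma deformation_identity:
  assumes "x \<in> carrier G" "y \<in> carrier G" "z \<in> carrier G"
  shows "\<phi> x (inv y) (y \<otimes> inv z) / \<phi> (inv y) y (inv z) * \<phi> x (inv z) z =
    \<phi> (x \<otimes> inv y) (y \<otimes> inv z) z * (\<phi> x (inv y) y * \<phi> y (inv z) z)"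
proof -
  have [simp]: "inv y \<otimes> (y \<otimes> inv z) = inv z" "y \<otimes> inv z \<otimes> z = y"
    using assms by (simp_all add: m_assoc[symmetric], simp add: m_assoc)
  have 1: "\<phi> (inv y) (y \<otimes> inv z) z * \<phi> x (inv z) z * \<phi> x (inv y) (y \<otimes> inv z) =
      \<phi> x (inv y) y * \<phi> (x \<otimes> inv y) (y \<otimes> inv z) z"
    using cocycle_eq[of x "inv y" "y \<otimes> inv z" z] assms by simp
  have 2: "\<phi> y (inv z) z * \<phi> (inv y) (y \<otimes> inv z) z * \<phi> (inv y) y (inv z) = 1"
    using cocycle_eq[of "inv y" y "inv z" z] assms
    by (simp add: cocycle_unit_left cocycle_unit_right)
  have "\<phi> (inv y) y (inv z) \<noteq> 0"
    using assms by (simp add: cocycle_nonzero)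
  moreover have "\<phi> x (inv y) (y \<otimes> inv z) * \<phi> x (inv z) z =
      \<phi> (x \<otimes> inv y) (y \<otimes> inv z) z * (\<phi> x (inv y) y * \<phi> y (inv z) z) * \<phi> (inv y) y (inv z)"
    using 1 2 by algebra
  ultimately show ?thesis
    by (simp add: divide_simps)
qed

end

lemma (in graded_space) linear_eq_on_homogeneous:
  assumes f: "Vector_Spaces.linear scale s f" and f': "Vector_Spaces.linear scale s f'"
    and eq: "\<And>g v. g \<in> carrier G \<Longrightarrow> v \<in> V g \<Longrightarrow> f v = f' v"
  shows "f v = f' v"
proof -
  interpret vector_space_pair scale s
    using f by (simp add: Vector_Spaces.linear_iff vector_space_pair_def)
  obtain c where c: "\<And>g. g \<in> carrier G \<Longrightarrow> c g \<in> V g" "\<And>g. g \<notin> carrier G \<Longrightarrow> c g = 0"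
      "v = (\<Sum>g | c g \<noteq> 0. c g)"
    using direct_sum[of v] by blast
  have "f (c g) = f' (c g)" if "c g \<noteq> 0" for g
    using eq c that by blast
  then show ?thesis
    by (subst (1 2) c(3)) (simp add: linear_sum[OF f] linear_sum[OF f'])
qed

text \<open>
  A finite basis given together with its coordinate functionals, so that column vectors (indexed by
  one index) and matrices (indexed by pairs) are graded by the same argument.
\<close>

locale finite_coordinates = vector_space scale
  for scale :: "'k::field \<Rightarrow> 'v::ab_group_add \<Rightarrow> 'v" +
  fixes coord :: "'v \<Rightarrow> 'i::finite \<Rightarrow> 'k" and basis :: "'i \<Rightarrow> 'v"
  assumes coord_add: "coord (v + w) i = coord v i + coord w i"
    and coord_scale: "coord (scale c v) i = c * coord v i"
    and coord_basis: "coord (basis i) j = (if i = j then 1 else 0)"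
    and expansion: "v = (\<Sum>i\<in>UNIV. scale (coord v i) (basis i))"
begin

lemma coord_zero: "coord 0 i = 0"
  using coord_scale[of 0 0 i] by simp

lemma coord_sum: "coord (sum f S) i = (\<Sum>s\<in>S. coord (f s) i)"
  by (induction S rule: infinite_finite_induct) (simp_all add: coord_zero coord_add)

lemma coord_eqI: "(\<And>i. coord v i = coord w i) \<Longrightarrow> v = w"
  by (subst (1 2) expansion) simp

lemma mem_span_basis_iff:
  "v \<in> span {basis i | i. D i = g} \<longleftrightarrow> (\<forall>i. coord v i \<noteq> 0 \<longrightarrow> D i = g)"
proof
  assume "v \<in> span {basis i | i. D i = g}"
  then show "\<forall>i. coord v i \<noteq> 0 \<longrightarrow> D i = g"
    by (induction rule: span_induct_alt)
      (auto simp: coord_zero coord_add coord_scale coord_basis split: if_splits)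
next
  assume *: "\<forall>i. coord v i \<noteq> 0 \<longrightarrow> D i = g"
  have "scale (coord v i) (basis i) \<in> span {basis i | i. D i = g}" for i
  proof (cases "coord v i = 0")
    case True
    then show ?thesis by (simp add: span_zero)
  next
    case False
    with * have "basis i \<in> {basis i | i. D i = g}" by blast
    then show ?thesis by (intro span_scale span_base)
  qed
  then show "v \<in> span {basis i | i. D i = g}"
    by (subst expansion) (rule span_sum)
qed

text \<open>
  The component of degree \<open>g\<close> of a vector keeps the coordinates at basis elements of degree \<open>g\<close>.
  It is unique because in a sum of homogeneous components the \<open>i\<close>-th coordinate comes only
  from the component of degree \<open>D i\<close>.
\<close>

lemma graded_space_span_basis:
  fixes G :: "('g, 'm) monoid_scheme"
  assumes D: "\<And>i. D i \<in> carrier G"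
  shows "graded_space G scale (\<lambda>g. span {basis i | i. D i = g})"
proof unfold_locales
  show "subspace (span {basis i | i. D i = g})" for g
    by simp
next
  fix v
  define c where "c g = (\<Sum>i\<in>UNIV. scale (if D i = g then coord v i else 0) (basis i))" for g
  have coord_c: "coord (c g) i = (if D i = g then coord v i else 0)" for g i
    unfolding c_def coord_sum coord_scale coord_basis
    by (simp add: if_distrib[of "(*) c" for c] cong: if_cong)
  have coord_at: "coord (\<Sum>g | f g \<noteq> 0. f g) i = coord (f (D i)) i"
    if "finite {g. f g \<noteq> 0}" "\<And>g. coord (f g) i \<noteq> 0 \<Longrightarrow> D i = g" for f i
  proof -
    have "coord (\<Sum>g | f g \<noteq> 0. f g) i =
        (\<Sum>g | f g \<noteq> 0. if g = D i then coord (f (D i)) i else 0)"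
      unfolding coord_sum using that(2) by (intro sum.cong) auto
    also have "\<dots> = coord (f (D i)) i"
      using that(1) by (auto simp: sum.delta coord_zero)
    finally show ?thesis .
  qed
  show "\<exists>!f. (\<forall>g\<in>carrier G. f g \<in> span {basis i | i. D i = g}) \<and>
      (\<forall>g. g \<notin> carrier G \<longrightarrow> f g = 0) \<and> finite {g. f g \<noteq> 0} \<and> v = (\<Sum>g | f g \<noteq> 0. f g)"
  proof (intro ex1I conjI allI ballI impI)
    show "c g \<in> span {basis i | i. D i = g}" for g
      by (auto simp: mem_span_basis_iff coord_c)
    show "c g = 0" if "g \<notin> carrier G" for g
      using that D by (auto intro!: coord_eqI simp: coord_c coord_zero)
    have "{g. c g \<noteq> 0} \<subseteq> range D"
    proof
      fix g assume "g \<in> {g. c g \<noteq> 0}"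
      then obtain i where "coord (c g) i \<noteq> coord 0 i"
        using coord_eqI by blast
      then show "g \<in> range D"
        by (auto simp: coord_c coord_zero split: if_splits)
    qed
    then show fin: "finite {g. c g \<noteq> 0}"
      by (rule finite_subset) simp
    show "v = (\<Sum>g | c g \<noteq> 0. c g)"
    proof (rule coord_eqI)
      fix i
      show "coord v i = coord (\<Sum>g | c g \<noteq> 0. c g) i"
        by (subst coord_at[OF fin]) (auto simp: coord_c split: if_splits)
    qed
  next
    fix f
    assume "(\<forall>g\<in>carrier G. f g \<in> span {basis i | i. D i = g}) \<and>
      (\<forall>g. g \<notin> carrier G \<longrightarrow> f g = 0) \<and> finite {g. f g \<noteq> 0} \<and> v = (\<Sum>g | f g \<noteq> 0. f g)"
    then have f: "\<And>g. g \<in> carrier G \<Longrightarrow> f g \<in> span {basis i | i. D i = g}"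
        "\<And>g. g \<notin> carrier G \<Longrightarrow> f g = 0" "finite {g. f g \<noteq> 0}" "v = (\<Sum>g | f g \<noteq> 0. f g)"
      by auto
    have supp: "D i = g" if "coord (f g) i \<noteq> 0" for g i
      using f(1,2)[of g] that by (cases "g \<in> carrier G") (auto simp: mem_span_basis_iff coord_zero)
    have v: "coord v i = coord (f (D i)) i" for i
      using coord_at[OF f(3) supp, of i] f(4) by simp
    show "f = c"
    proof (rule ext, rule coord_eqI)
      fix g i
      show "coord (f g) i = coord (c g) i"
        using supp[of g i] v[of i] by (auto simp: coord_c)
    qed
  qed
qed

end


section \<open>Faithful actions\<close>

text \<open>
  On a homogeneous vector, \<open>(ab)c\<close> and \<open>a(bc)\<close> both act as a scalar multiple of
  \<open>a \<rhd> (b \<rhd> (c \<rhd> v))\<close>; the ratio of the two scalars is \<open>\<phi>(|a|,|b|,|c|)\<close> by the cocycle equation,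
  whatever the degree of \<open>v\<close>. The unit laws follow in the same way from the normalization of
  \<open>\<phi>\<close>.
\<close>

lemma graded_quasialgebra_of_faithful_action:
  fixes G :: "('g, 'm) monoid_scheme" (structure)
  assumes cocycle: "three_cocycle G \<phi>" and grB: "graded_space G sB B" and grV: "graded_space G sV V"
    and action: "quasialgebra_action G \<phi> sB B mul unit sV V act"
    and faithful: "\<And>a b. (\<And>v. act a v = act b v) \<Longrightarrow> a = b"
    and mul: "bilinear_over sB sB sB mul"
    and mul_degree: "\<And>g h a b. \<lbrakk>g \<in> carrier G; h \<in> carrier G; a \<in> B g; b \<in> B h\<rbrakk>
        \<Longrightarrow> mul a b \<in> B (g \<otimes> h)"
    and unit_degree: "unit \<in> B \<one>"
  shows "graded_quasialgebra G \<phi> sB B mul unit"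
proof -
  interpret three_cocycle G \<phi> by fact
  interpret B: graded_space G sB B by fact
  interpret V: graded_space G sV V by fact
  have lin: "Vector_Spaces.linear sV sV (act a)" "Vector_Spaces.linear sB sV (\<lambda>a. act a v)"
      "Vector_Spaces.linear sB sB (mul a)" "Vector_Spaces.linear sB sB (\<lambda>a. mul a b)" for a b v
    using action mul by (simp_all add: quasialgebra_action_def bilinear_over_def)
  have act_degree: "act a v \<in> V (g \<otimes> h)"
    if "g \<in> carrier G" "h \<in> carrier G" "a \<in> B g" "v \<in> V h" for g h a v
    using action that by (simp add: quasialgebra_action_def)
  have act_mul: "act (mul a b) v = sV (\<phi> g h l) (act a (act b v))"
    if "g \<in> carrier G" "h \<in> carrier G" "l \<in> carrier G" "a \<in> B g" "b \<in> B h" "v \<in> V l"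
    for g h l a b v
    using action that by (simp add: quasialgebra_action_def)
  have act_unit: "act unit v = v" for v
    using action by (simp add: quasialgebra_action_def)
  have act_scale: "act (sB c a) v = sV c (act a v)" "act a (sV c v) = sV c (act a v)" for c a v
    using lin(1)[of a] lin(2)[of v] by (simp_all add: Vector_Spaces.linear_iff)
  have eqI: "a = b"
    if "\<And>g v. g \<in> carrier G \<Longrightarrow> v \<in> V g \<Longrightarrow> act a v = act b v" for a b
    using V.linear_eq_on_homogeneous[OF lin(1) lin(1)] that by (intro faithful) blast
  show ?thesis
  proof unfold_locales
    show "bilinear_over sB sB sB mul" "unit \<in> B \<one>" by fact+
    show "mul a b \<in> B (g \<otimes> h)"
      if "g \<in> carrier G" "h \<in> carrier G" "a \<in> B g" "b \<in> B h" for g h a b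
      using mul_degree that .
    have "mul unit a = a" if "h \<in> carrier G" "a \<in> B h" for h a
      using act_mul[of \<one> h _ unit a] that unit_degree
      by (intro eqI) (simp add: cocycle_unit_left act_unit)
    then show "mul unit a = a" for a
      using B.linear_eq_on_homogeneous[OF lin(3) B.linear_ident] by blast
    have "mul a unit = a" if "h \<in> carrier G" "a \<in> B h" for h a
      using act_mul[of h \<one> _ a unit] that unit_degree
      by (intro eqI) (simp add: cocycle_unit act_unit)
    then show "mul a unit = a" for a
      using B.linear_eq_on_homogeneous[OF lin(4) B.linear_ident] by blast
    show "mul (mul a b) c = sB (\<phi> g h l) (mul a (mul b c))"
      if gr: "g \<in> carrier G" "h \<in> carrier G" "l \<in> carrier G" "a \<in> B g" "b \<in> B h" "c \<in> B l"
      for g h l a b c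
    proof (rule eqI)
      fix m v assume m: "m \<in> carrier G" "v \<in> V m"
      have "act (mul (mul a b) c) v =
          sV (\<phi> (g \<otimes> h) l m * \<phi> g h (l \<otimes> m)) (act a (act b (act c v)))"
        using gr m by (simp add: act_mul[of "g \<otimes> h" l m] act_mul[of g h "l \<otimes> m"]
            mul_degree act_degree)
      also have "\<phi> (g \<otimes> h) l m * \<phi> g h (l \<otimes> m) = \<phi> g h l * (\<phi> g (h \<otimes> l) m * \<phi> h l m)"
        using cocycle_eq[of g h l m] gr m by (simp add: ac_simps)
      also have "sV \<dots> (act a (act b (act c v))) = act (sB (\<phi> g h l) (mul a (mul b c))) v"
        using gr m by (simp add: act_mul[of g "h \<otimes> l" m] act_mul[of h l m]
            mul_degree act_scale)
      finally show "act (mul (mul a b) c) v = act (sB (\<phi> g h l) (mul a (mul b c))) v" .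
    qed
  qed
qed

lemma quasialgebra_action_pullback:
  assumes "quasialgebra_action G \<phi> sB B mulB unitB sV V act"
    and "quasialgebra_map G sA A mulA unitA sB B mulB unitB \<rho>"
  shows "quasialgebra_action G \<phi> sA A mulA unitA sV V (\<lambda>a. act (\<rho> a))"
  using assms
  by (simp add: quasialgebra_action_def quasialgebra_map_def bilinear_over_def Vector_Spaces.linear_iff)

text \<open>
  A degree-preserving \<open>\<rho>\<close> that realizes one action through a faithful one inherits linearity,
  multiplicativity and unitality: each is an equation in \<open>B\<close> that can be tested on vectors, where it
  becomes the corresponding law of the two actions. Preservation of degree is what makes the
  cocycle factors of the two action laws agree.
\<close>

lemma quasialgebra_map_of_faithful_action:
  fixes G :: "('g, 'm) monoid_scheme" (structure)
  assumes grA: "graded_space G sA A" and grV: "graded_space G sV V"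
    and mulA: "bilinear_over sA sA sA mulA" and mulB: "bilinear_over sB sB sB mulB"
    and actB: "quasialgebra_action G \<phi> sB B mulB unitB sV V actB"
    and faithful: "\<And>a b. (\<And>v. actB a v = actB b v) \<Longrightarrow> a = b"
    and actA: "quasialgebra_action G \<phi> sA A mulA unitA sV V actA"
    and rho: "\<And>a v. actB (\<rho> a) v = actA a v"
    and rho_degree: "\<And>g a. g \<in> carrier G \<Longrightarrow> a \<in> A g \<Longrightarrow> \<rho> a \<in> B g"
  shows "quasialgebra_map G sA A mulA unitA sB B mulB unitB \<rho>"
proof -
  interpret A: graded_space G sA A by fact
  interpret V: graded_space G sV V by fact
  have linA: "Vector_Spaces.linear sV sV (actA a)" "Vector_Spaces.linear sA sV (\<lambda>a. actA a v)"
      "Vector_Spaces.linear sA sA (mulA a)" "Vector_Spaces.linear sA sA (\<lambda>a. mulA a b)" for a b v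
    using actA mulA by (simp_all add: quasialgebra_action_def bilinear_over_def)
  have linB: "Vector_Spaces.linear sV sV (actB x)" "Vector_Spaces.linear sB sV (\<lambda>x. actB x v)"
      "Vector_Spaces.linear sB sB (mulB x)" "Vector_Spaces.linear sB sB (\<lambda>x. mulB x y)" for x y v
    using actB mulB by (simp_all add: quasialgebra_action_def bilinear_over_def)
  have lin_rho: "Vector_Spaces.linear sA sB \<rho>"
    unfolding Vector_Spaces.linear_iff
  proof (intro conjI allI)
    show "vector_space sA" "vector_space sB"
      using linA(3) linB(3) by (auto simp: Vector_Spaces.linear_iff)
    show "\<rho> (a + b) = \<rho> a + \<rho> b" for a b
      using linA(2) linB(2) by (intro faithful) (simp add: rho Vector_Spaces.linear_iff)
    show "\<rho> (sA c a) = sB c (\<rho> a)" for c a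
      using linA(2) linB(2) by (intro faithful) (simp add: rho Vector_Spaces.linear_iff)
  qed
  have mul_homogeneous: "\<rho> (mulA a b) = mulB (\<rho> a) (\<rho> b)"
    if gr: "g \<in> carrier G" "h \<in> carrier G" "a \<in> A g" "b \<in> A h" for g h a b
  proof (rule faithful, rule V.linear_eq_on_homogeneous[OF linB(1) linB(1)])
    fix l v assume l: "l \<in> carrier G" "v \<in> V l"
    have "actB (\<rho> (mulA a b)) v = sV (\<phi> g h l) (actA a (actA b v))"
      using actA gr l by (simp add: rho quasialgebra_action_def)
    also have "\<dots> = actB (mulB (\<rho> a) (\<rho> b)) v"
      using actB gr l rho_degree by (simp add: rho quasialgebra_action_def)
    finally show "actB (\<rho> (mulA a b)) v = actB (mulB (\<rho> a) (\<rho> b)) v" .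
  qed
  have lin_comp: "Vector_Spaces.linear sA sB (\<lambda>a. \<rho> (mulA a b))"
      "Vector_Spaces.linear sA sB (\<lambda>b. \<rho> (mulA a b))"
      "Vector_Spaces.linear sA sB (\<lambda>a. mulB (\<rho> a) y)"
      "Vector_Spaces.linear sA sB (\<lambda>b. mulB x (\<rho> b))" for a b x y
    using lin_rho linA(3,4) linB(3,4) by (simp_all add: Vector_Spaces.linear_iff)
  have mul_left: "\<rho> (mulA a b) = mulB (\<rho> a) (\<rho> b)" if "g \<in> carrier G" "a \<in> A g" for g a b
    using A.linear_eq_on_homogeneous[OF lin_comp(2) lin_comp(4)] mul_homogeneous that by blast
  have "\<rho> (mulA a b) = mulB (\<rho> a) (\<rho> b)" for a b
    using A.linear_eq_on_homogeneous[OF lin_comp(1) lin_comp(3)] mul_left by blast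
  moreover have "\<rho> unitA = unitB"
    using actA actB by (intro faithful) (simp add: rho quasialgebra_action_def)
  ultimately show ?thesis
    using lin_rho rho_degree by (simp add: quasialgebra_map_def)
qed


section \<open>The deformed matrices\<close>

lemma finite_coordinates_vec:
  "finite_coordinates ((*s) :: 'k::field \<Rightarrow> 'k ^ 'n \<Rightarrow> 'k ^ 'n::finite) ($) (\<lambda>i. axis i 1)"
  by unfold_locales (simp_all add: basis_expansion, simp add: axis_def)

lemma finite_coordinates_mat:
  "finite_coordinates (mat_scale :: 'k::field \<Rightarrow> 'k ^ 'n ^ 'n::finite \<Rightarrow> 'k ^ 'n ^ 'n)
     (\<lambda>M (i, j). M $ i $ j) (\<lambda>(i, j). mat_unit i j)"
proof unfold_locales
  show "M = (\<Sum>p\<in>UNIV. mat_scale (case p of (i, j) \<Rightarrow> M $ i $ j) (case p of (i, j) \<Rightarrow> mat_unit i j))"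
    for M :: "'k ^ 'n ^ 'n"
  proof -
    have "(\<Sum>p\<in>UNIV. mat_scale (case p of (i, j) \<Rightarrow> M $ i $ j) (case p of (i, j) \<Rightarrow> mat_unit i j))
        $ r $ s = (\<Sum>p\<in>UNIV. if p = (r, s) then M $ r $ s else 0)" for r s
      unfolding sum_component
      by (intro sum.cong) (auto simp: mat_scale_def mat_unit_def split: if_splits)
    then show ?thesis
      by (simp add: vec_eq_iff)
  qed
qed (auto simp: mat_scale_def mat_unit_def vec_eq_iff algebra_simps split: if_splits)

lemma vec_grading_iff:
  "v \<in> vec_grading d g \<longleftrightarrow> (\<forall>i. v $ i \<noteq> 0 \<longrightarrow> d i = g)"
proof -
  interpret finite_coordinates "(*s)" "($)" "\<lambda>i. axis i 1 :: 'a ^ 'b"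
    by (rule finite_coordinates_vec)
  show ?thesis
    unfolding vec_grading_def by (rule mem_span_basis_iff)
qed

lemma graded_space_vec_grading:
  fixes G :: "('g, 'm) monoid_scheme" and d :: "'n::finite \<Rightarrow> 'g"
  assumes "\<And>i. d i \<in> carrier G"
  shows "graded_space G ((*s) :: 'k::field \<Rightarrow> 'k ^ 'n \<Rightarrow> 'k ^ 'n) (vec_grading d)"
proof -
  interpret finite_coordinates "(*s)" "($)" "\<lambda>i. axis i 1 :: 'k ^ 'n"
    by (rule finite_coordinates_vec)
  show ?thesis
    using graded_space_span_basis[of d G] assms by (simp add: vec_grading_def[abs_def])
qed

text \<open>
  The spanning set, re-indexed by pairs to match the basis of \<open>finite_coordinates_mat\<close>.
\<close>

lemma mat_grading_eq_span:
  "mat_grading G d g =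
     module.span mat_scale {(case p of (i, j) \<Rightarrow> mat_unit i j) | p.
       (case p of (i, j) \<Rightarrow> d i \<otimes>\<^bsub>G\<^esub> inv\<^bsub>G\<^esub> d j) = g}"
  unfolding mat_grading_def by (rule arg_cong[of _ _ "module.span mat_scale"]) auto

lemma mat_grading_iff:
  fixes M :: "'k::field ^ 'n ^ 'n::finite"
  shows "M \<in> mat_grading G d g \<longleftrightarrow> (\<forall>i j. M $ i $ j \<noteq> 0 \<longrightarrow> d i \<otimes>\<^bsub>G\<^esub> inv\<^bsub>G\<^esub> d j = g)"
proof -
  interpret finite_coordinates mat_scale "\<lambda>M (i, j). M $ i $ j"
      "\<lambda>(i, j). mat_unit i j :: 'k ^ 'n ^ 'n"
    by (rule finite_coordinates_mat)
  show ?thesis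
    unfolding mat_grading_eq_span mem_span_basis_iff by auto
qed

locale graded_index = three_cocycle G \<phi>
  for G :: "('g, 'm) monoid_scheme" (structure)
  and \<phi> :: "'g \<Rightarrow> 'g \<Rightarrow> 'g \<Rightarrow> 'k::field" +
  fixes d :: "'n::finite \<Rightarrow> 'g"
  assumes d_closed [simp]: "d i \<in> carrier G"
begin

lemma graded_space_mat_grading:
  "graded_space G (mat_scale :: 'k \<Rightarrow> _) (mat_grading G d)"
proof -
  interpret finite_coordinates mat_scale "\<lambda>M (i, j). M $ i $ j"
      "\<lambda>(i, j). mat_unit i j :: 'k ^ 'n ^ 'n"
    by (rule finite_coordinates_mat)
  show ?thesis
    using graded_space_span_basis[of "\<lambda>(i, j). d i \<otimes> inv d j" G]
    by (simp add: mat_grading_eq_span[abs_def] split: prod.splits)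
qed

lemma evaluation_nonzero: "\<phi> (d i) (inv d j) (d j) \<noteq> 0"
  by (simp add: cocycle_nonzero)

lemma degree_quotient_eq_iff:
  assumes "g \<in> carrier G"
  shows "d i \<otimes> inv d j = g \<longleftrightarrow> d i = g \<otimes> d j"
  using assms by (metis d_closed inv_closed inv_solve_right m_closed)

lemma mat_qact_axis:
  "mat_qact G \<phi> d M (axis j 1) $ i = M $ i $ j * \<phi> (d i) (inv d j) (d j)"
  by (simp add: mat_qact_def axis_def if_distrib cong: if_cong)

lemma mat_qact_faithful:
  assumes "\<And>v. mat_qact G \<phi> d M v = mat_qact G \<phi> d N v"
  shows "M = N"
proof -
  have "M $ i $ j = N $ i $ j" for i j
    using mat_qact_axis[of M j i] mat_qact_axis[of N j i] assms evaluation_nonzero[of i j] by simp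
  then show ?thesis
    by (simp add: vec_eq_iff)
qed

lemma mat_qact_degree:
  assumes g: "g \<in> carrier G" and M: "M \<in> mat_grading G d g" and v: "v \<in> vec_grading d h"
  shows "mat_qact G \<phi> d M v \<in> vec_grading d (g \<otimes> h)"
  unfolding vec_grading_iff
proof (intro allI impI)
  fix i assume "mat_qact G \<phi> d M v $ i \<noteq> 0"
  then obtain j where "M $ i $ j \<noteq> 0" "v $ j \<noteq> 0"
    by (auto simp: mat_qact_def elim!: sum.not_neutral_contains_not_neutral)
  then show "d i = g \<otimes> h"
    using M v degree_quotient_eq_iff[OF g, of i j] by (auto simp: mat_grading_iff vec_grading_iff)
qed

lemma mat_qmul_degree:
  assumes "M \<in> mat_grading G d g" "N \<in> mat_grading G d h"
  shows "mat_qmul G \<phi> d M N \<in> mat_grading G d (g \<otimes> h)"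
  unfolding mat_grading_iff
proof (intro allI impI)
  fix i j assume "mat_qmul G \<phi> d M N $ i $ j \<noteq> 0"
  then obtain k where "M $ i $ k \<noteq> 0" "N $ k $ j \<noteq> 0"
    by (auto simp: mat_qmul_def elim!: sum.not_neutral_contains_not_neutral)
  then have "g \<otimes> h = (d i \<otimes> inv d k) \<otimes> (d k \<otimes> inv d j)"
    using assms by (auto simp: mat_grading_iff)
  also have "\<dots> = d i \<otimes> (inv d k \<otimes> d k) \<otimes> inv d j"
    by (simp only: m_assoc m_closed inv_closed d_closed)
  finally show "d i \<otimes> inv d j = g \<otimes> h"
    by simp
qed

lemma mat_qact_qmul:
  assumes M: "M \<in> mat_grading G d g" and N: "N \<in> mat_grading G d h" and v: "v \<in> vec_grading d l"
  shows "mat_qact G \<phi> d (mat_qmul G \<phi> d M N) v =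
    \<phi> g h l *s mat_qact G \<phi> d M (mat_qact G \<phi> d N v)"
proof -
  have summand: "M $ i $ k * N $ k $ j *
        (\<phi> (d i) (inv d k) (d k \<otimes> inv d j) / \<phi> (inv d k) (d k) (inv d j)) *
        \<phi> (d i) (inv d j) (d j) * v $ j =
      \<phi> g h l * (M $ i $ k * \<phi> (d i) (inv d k) (d k) * (N $ k $ j * \<phi> (d k) (inv d j) (d j) * v $ j))"
    for i j k
  proof (cases "M $ i $ k = 0 \<or> N $ k $ j = 0 \<or> v $ j = 0")
    case False
    then have degrees: "g = d i \<otimes> inv d k" "h = d k \<otimes> inv d j" "l = d j"
      using M N v by (auto simp: mat_grading_iff vec_grading_iff)
    have "\<phi> (d i) (inv d k) (d k \<otimes> inv d j) / \<phi> (inv d k) (d k) (inv d j) *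
        \<phi> (d i) (inv d j) (d j) =
        \<phi> g h l * (\<phi> (d i) (inv d k) (d k) * \<phi> (d k) (inv d j) (d j))"
      unfolding degrees by (rule deformation_identity) simp_all
    then show ?thesis
      by (simp only: ac_simps)
  qed auto
  have "mat_qact G \<phi> d (mat_qmul G \<phi> d M N) v $ i =
      \<phi> g h l * mat_qact G \<phi> d M (mat_qact G \<phi> d N v) $ i" for i
  proof -
    have "mat_qact G \<phi> d (mat_qmul G \<phi> d M N) v $ i = (\<Sum>j\<in>UNIV. \<Sum>k\<in>UNIV. M $ i $ k * N $ k $ j *
        (\<phi> (d i) (inv d k) (d k \<otimes> inv d j) / \<phi> (inv d k) (d k) (inv d j)) *
        \<phi> (d i) (inv d j) (d j) * v $ j)"
      by (simp only: mat_qact_def mat_qmul_def vec_lambda_beta sum_distrib_right)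
    also have "\<dots> = (\<Sum>k\<in>UNIV. \<Sum>j\<in>UNIV. M $ i $ k * N $ k $ j *
        (\<phi> (d i) (inv d k) (d k \<otimes> inv d j) / \<phi> (inv d k) (d k) (inv d j)) *
        \<phi> (d i) (inv d j) (d j) * v $ j)"
      by (rule sum.swap)
    also have "\<dots> = \<phi> g h l * mat_qact G \<phi> d M (mat_qact G \<phi> d N v) $ i"
      by (simp only: summand mat_qact_def vec_lambda_beta sum_distrib_left)
    finally show ?thesis .
  qed
  then show ?thesis
    by (simp add: vec_eq_iff)
qed

lemma mat_qact_qunit: "mat_qact G \<phi> d (mat_qunit G \<phi> d) v = v"
proof -
  have "mat_qact G \<phi> d (mat_qunit G \<phi> d) v $ i = (\<Sum>j\<in>UNIV. if j = i then v $ i else 0)" for i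
    unfolding mat_qact_def mat_qunit_def vec_lambda_beta
    using evaluation_nonzero by (intro sum.cong) auto
  then show ?thesis
    by (simp add: vec_eq_iff)
qed

lemma mat_qunit_degree: "mat_qunit G \<phi> d \<in> mat_grading G d \<one>"
  by (auto simp: mat_grading_iff mat_qunit_def)

lemma vector_space_mat_scale: "vector_space (mat_scale :: 'k \<Rightarrow> 'k ^ 'n ^ 'n \<Rightarrow> _)"
  using finite_coordinates_mat by (rule finite_coordinates.axioms)

lemma mat_qmul_bilinear:
  "bilinear_over (mat_scale :: 'k \<Rightarrow> _) mat_scale mat_scale (mat_qmul G \<phi> d)"
  by (auto simp: bilinear_over_def Vector_Spaces.linear_iff vector_space_mat_scale vec_eq_iff mat_qmul_def
      mat_scale_def distrib_left distrib_right add_divide_distrib sum.distrib sum_distrib_left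
      mult.assoc mult.left_commute intro!: sum.cong)

lemma mat_qact_bilinear:
  "bilinear_over (mat_scale :: 'k \<Rightarrow> _) (*s) (*s) (mat_qact G \<phi> d)"
  by (auto simp: bilinear_over_def Vector_Spaces.linear_iff vector_space_mat_scale vec.vector_space_axioms
      vec_eq_iff mat_qact_def mat_scale_def distrib_left distrib_right sum.distrib
      sum_distrib_left mult.assoc mult.left_commute intro!: sum.cong)

lemma quasialgebra_action_mat_qact:
  "quasialgebra_action G \<phi> mat_scale (mat_grading G d) (mat_qmul G \<phi> d) (mat_qunit G \<phi> d)
     (*s) (vec_grading d) (mat_qact G \<phi> d)"
  by (simp add: quasialgebra_action_def mat_qact_bilinear mat_qact_degree mat_qact_qmul
      mat_qact_qunit)

lemma graded_quasialgebra_mat: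
  "graded_quasialgebra G \<phi> mat_scale (mat_grading G d) (mat_qmul G \<phi> d) (mat_qunit G \<phi> d)"
  by (rule graded_quasialgebra_of_faithful_action[OF three_cocycle_axioms graded_space_mat_grading
        graded_space_vec_grading[of d G, OF d_closed] quasialgebra_action_mat_qact])
    (auto intro: mat_qact_faithful mat_qmul_bilinear mat_qmul_degree mat_qunit_degree)

text \<open>
  Surjectivity of the passage from matrices to endomorphisms: dividing the entries of the ordinary
  matrix of \<open>f\<close> by the nonzero cocycle factors undoes the twist in the action.
\<close>

lemma mat_qact_realizes_linear:
  assumes f: "Vector_Spaces.linear (*s) (*s) f"
  shows "mat_qact G \<phi> d (\<chi> i j. f (axis j 1) $ i / \<phi> (d i) (inv d j) (d j)) v = f v"
proof -
  have "mat_qact G \<phi> d (\<chi> i j. f (axis j 1) $ i / \<phi> (d i) (inv d j) (d j)) v = matrix f *v v"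
    by (simp add: mat_qact_def matrix_vector_mult_def matrix_def evaluation_nonzero)
  also have "\<dots> = f v"
    by (rule matrix_works[OF f])
  finally show ?thesis .
qed

text \<open>
  The degree of a matrix is detected by its action, since column \<open>j\<close> is, up to nonzero factors, the
  image of \<open>e\<^sub>j\<close>.
\<close>

lemma mat_grading_of_qact:
  assumes g: "g \<in> carrier G"
    and deg: "\<And>h v. h \<in> carrier G \<Longrightarrow> v \<in> vec_grading d h \<Longrightarrow>
      mat_qact G \<phi> d M v \<in> vec_grading d (g \<otimes> h)"
  shows "M \<in> mat_grading G d g"
  unfolding mat_grading_iff
proof (intro allI impI)
  fix i j assume "M $ i $ j \<noteq> 0"
  then have "mat_qact G \<phi> d M (axis j 1) $ i \<noteq> 0"
    by (simp add: mat_qact_axis evaluation_nonzero)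
  moreover have "mat_qact G \<phi> d M (axis j 1) \<in> vec_grading d (g \<otimes> d j)"
    by (rule deg) (auto simp: vec_grading_iff axis_def)
  ultimately show "d i \<otimes> inv d j = g"
    using degree_quotient_eq_iff[OF g] unfolding vec_grading_iff by blast
qed

lemma bij_betw_maps_actions:
  assumes "graded_quasialgebra G \<phi> sA A mul unit"
  shows "bij_betw (\<lambda>\<rho> a v. mat_qact G \<phi> d (\<rho> a) v)
    {\<rho>. quasialgebra_map G sA A mul unit
          mat_scale (mat_grading G d) (mat_qmul G \<phi> d) (mat_qunit G \<phi> d) \<rho>}
    {act. quasialgebra_action G \<phi> sA A mul unit (*s) (vec_grading d) act}"
    (is "bij_betw ?F ?maps ?actions")
proof -
  interpret A: graded_quasialgebra G \<phi> sA A mul unit by fact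
  have "inj_on ?F ?maps"
  proof (rule inj_onI)
    fix \<rho> \<sigma> assume "?F \<rho> = ?F \<sigma>"
    then show "\<rho> = \<sigma>"
      by (intro ext mat_qact_faithful) (simp add: fun_eq_iff)
  qed
  moreover have "?F ` ?maps \<subseteq> ?actions"
    using quasialgebra_action_pullback[OF quasialgebra_action_mat_qact] by blast
  moreover have "?actions \<subseteq> ?F ` ?maps"
  proof
    fix act assume "act \<in> ?actions"
    then have act: "quasialgebra_action G \<phi> sA A mul unit (*s) (vec_grading d) act"
      by simp
    define \<rho> where "\<rho> a = (\<chi> i j. act a (axis j 1) $ i / \<phi> (d i) (inv d j) (d j))" for a
    have rho: "mat_qact G \<phi> d (\<rho> a) v = act a v" for a v
      unfolding \<rho>_def using act
      by (intro mat_qact_realizes_linear) (simp add: quasialgebra_action_def bilinear_over_def)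
    have "\<rho> a \<in> mat_grading G d g" if "g \<in> carrier G" "a \<in> A g" for g a
      using act that by (intro mat_grading_of_qact) (simp_all add: rho quasialgebra_action_def)
    then have "\<rho> \<in> ?maps"
      using quasialgebra_map_of_faithful_action[OF A.graded_space_axioms
          graded_space_vec_grading[of d G, OF d_closed] A.mul_bilinear mat_qmul_bilinear
          quasialgebra_action_mat_qact mat_qact_faithful act rho]
      by blast
    moreover have "act = ?F \<rho>"
      by (simp add: rho)
    ultimately show "act \<in> ?F ` ?maps"
      by blast
  qed
  ultimately show ?thesis
    unfolding bij_betw_def by blast
qed

end

theorem proposition7p3:
  fixes G :: "('g, 'm) monoid_scheme"
    and \<phi> :: "'g \<Rightarrow> 'g \<Rightarrow> 'g \<Rightarrow> 'k::field"
    and d :: "'n::finite \<Rightarrow> 'g"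
  assumes "three_cocycle G \<phi>"
    and "\<And>i. d i \<in> carrier G"
  shows "graded_quasialgebra G \<phi> mat_scale (mat_grading G d) (mat_qmul G \<phi> d) (mat_qunit G \<phi> d) \<and>
    graded_space G ((*s) :: 'k \<Rightarrow> 'k ^ 'n \<Rightarrow> 'k ^ 'n) (vec_grading d) \<and>
    (\<forall>(scale :: 'k \<Rightarrow> 'a::ab_group_add \<Rightarrow> 'a) A mul unit.
       graded_quasialgebra G \<phi> scale A mul unit \<longrightarrow>
       bij_betw (\<lambda>\<rho> a v. mat_qact G \<phi> d (\<rho> a) v)
         {\<rho>. quasialgebra_map G scale A mul unit
               mat_scale (mat_grading G d) (mat_qmul G \<phi> d) (mat_qunit G \<phi> d) \<rho>}
         {act. quasialgebra_action G \<phi> scale A mul unit (*s) (vec_grading d) act})"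
proof -
  interpret graded_index G \<phi> d
    using assms by (simp add: graded_index_def graded_index_axioms_def)
  show ?thesis
    using graded_quasialgebra_mat graded_space_vec_grading[of d G, OF d_closed] bij_betw_maps_actions
    by blast
qed

end
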